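(* Let $\mathcal{F}$ be the Anosov foliation of the unit tangent bundle of the modular surface, i.e. the hyperbolic surface foliation of $(\mathbb{H}^2\times\mathbb{S}^1)/PSL(2,\mathbb{Z})$. Let $L=L_{[0]}$ be the leaf covered by $\mathbb{H}^2\times\{0\}$, let $x\in L$ have a lift $\tilde x\in\mathbb{H}^2$ that is not an elliptic point for the action of $PSL(2,\mathbb{Z})$, let $T$ be the fiber transversal through $x$, and let ${\sf f}$ be the frame field on $T$ obtained by lifting a frame on the modular surface based at the projection of $T$. Then, as a set, $$[\![\pi]\!]_1(\mathcal{F},x,{\sf f})\;=\;PSL(2,{}^{\ast}\mathbb{Z}).$$
   Context: Anosov foliation. $\Gamma=PSL(2,\mathbb{Z})$ acts on $\mathbb{H}^2$ and on its boundary $\mathbb{S}^1\approx\mathbb{R}\cup\{\infty\}$; $\Sigma=\mathbb{H}^2/\Gamma$ is the modular surface (orbifold). The suspension $(\mathbb{H}^2\times\mathbb{S}^1)/\Gamma$ (diagonal action) is identified with ${\rm T}_1\Sigma={\rm T}_1\mathbb{H}^2/\Gamma$ by sending $(\tilde z,t)$ to the unit vector at $\tilde z$ tangent to the ray limiting to $t$. $\mathcal{F}$ is the foliation with leaves the images of $\mathbb{H}^2\times\{t\}$, with the hyperbolic metric; all leaves are dense. $L_{[r]}$ denotes the image of $\mathbb{H}^2\times\{r\}$. Nonstandard notation. Fix an ultrafilter $\mathfrak{U}$ on $\mathbb{N}$ all of whose elements are infinite. ${}^{\ast}X$ is the set of sequences in $X$ modulo $\{x_i\}\sim\{y_i\}$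 iff $x_i=y_i$ for all $i$ in some element of $\mathfrak{U}$. Thus ${}^{\ast}\mathbb{Z}$ is the ring of nonstandard integers and $PSL(2,{}^{\ast}\mathbb{Z})={}^{\ast}PSL(2,\mathbb{Z})\subset PSL(2,{}^{\ast}\mathbb{R})={}^{\ast}PSL(2,\mathbb{R})$. Fundamental germ (constant curvature case). Write ${\sf f}_y$ for the value of ${\sf f}$ at $y\in T$, $T_0=T\cap L$, $\widetilde T_0\subset\mathbb{H}^2$ for the preimage of $T_0$ in the universal cover $\mathbb{H}^2\to L$, and $\tilde{\sf f}$ for the lift of ${\sf f}$ to $\widetilde T_0$. For a sequence $\{x_\alpha\}\subset T_0$ converging to $x$ in $T$ and lifts $\tilde x_\alpha\in\widetilde T_0$, there are unique isometries $A_\alpha$ of $\mathbb{H}^2$ taking $\tilde{\sf f}_{\tilde x}$ to $\tilde{\sf f}_{\tilde x_\alpha}$; a sequence $\{A_\alpha\}$ so obtained (equivalently its class in ${}^{\ast}{\sf Isom}(\mathbb{H}^2)$) is an ${\sf f}$-diophantine approximation of $x$. The fundamental germ $[\![\pi]\!]_1(\mathcal{F},x,{\sf f})$ is the set of all classes in ${}^{\ast}{\sf Isom}(\mathbb{H}^2)$ of sequences $\{A_\alpha B_\alpha^{-1}\}$ with $\{A_\alpha\},\{B_\alpha\}$ ${\sf f}$-diophantine approximations of $x$. *)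

theory Defs
  imports "HOL-Analysis.Analysis"
begin

subsection \<open>Nonstandard extensions\<close>

definition free_ultrafilter :: "nat filter \<Rightarrow> bool" where
  "free_ultrafilter U \<longleftrightarrow> U \<noteq> bot
     \<and> (\<forall>P. eventually P U \<or> eventually (\<lambda>n. \<not> P n) U)
     \<and> (\<forall>P. eventually P U \<longrightarrow> infinite {n. P n})"

definition star_class :: "nat filter \<Rightarrow> (nat \<Rightarrow> 'a) \<Rightarrow> (nat \<Rightarrow> 'a) set" where
  "star_class U x = {y. eventually (\<lambda>n. x n = y n) U}"

text \<open>Classes are taken among all sequences in the type, so that an inclusion of \<open>X\<close>
  in \<open>Y\<close> induces a literal inclusion of \<open>star U X\<close> in \<open>star U Y\<close>.\<close>

definition star :: "nat filter \<Rightarrow> 'a set \<Rightarrow> (nat \<Rightarrow> 'a) set set" where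
  "star U X = {star_class U x | x. \<forall>n. x n \<in> X}"

text \<open>Nonstandard extension of a binary operation; on classes this is the class of
  the termwise operation.\<close>

definition star_op :: "nat filter \<Rightarrow> ('a \<Rightarrow> 'b \<Rightarrow> 'c) \<Rightarrow>
    (nat \<Rightarrow> 'a) set \<Rightarrow> (nat \<Rightarrow> 'b) set \<Rightarrow> (nat \<Rightarrow> 'c) set" where
  "star_op U h X Y = {z. \<exists>x\<in>X. \<exists>y\<in>Y. eventually (\<lambda>n. z n = h (x n) (y n)) U}"

lemma star_op_class: "star_op U h (star_class U x) (star_class U y) = star_class U (\<lambda>n. h (x n) (y n))"
proof -
  have "eventually (\<lambda>n. h (x n) (y n) = z n) U"
    if "eventually (\<lambda>n. x n = x' n) U" "eventually (\<lambda>n. y n = y' n) U"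
       "eventually (\<lambda>n. z n = h (x' n) (y' n)) U" for x' y' z
    using that by eventually_elim simp
  moreover have "\<exists>x'\<in>star_class U x. \<exists>y'\<in>star_class U y. eventually (\<lambda>n. z n = h (x' n) (y' n)) U"
    if "eventually (\<lambda>n. h (x n) (y n) = z n) U" for z
    using that by (intro bexI[of _ x] bexI[of _ y]) (auto simp: star_class_def eq_commute)
  ultimately show ?thesis
    unfolding star_op_def by (auto simp: star_class_def)
qed

subsection \<open>The hyperbolic plane and its isometries\<close>

typedef uhp = "{z :: complex. 0 < Im z}" morphisms of_uhp Uhp
  by (rule exI[of _ \<i>]) simp

definition hdist :: "uhp \<Rightarrow> uhp \<Rightarrow> real" where
  "hdist z w = arcosh (1 + (cmod (of_uhp z - of_uhp w))\<^sup>2 / (2 * Im (of_uhp z) * Im (of_uhp w)))"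

definition uhp_isometries :: "(uhp \<Rightarrow> uhp) set" where
  "uhp_isometries = {A. bij A \<and> (\<forall>z w. hdist (A z) (A w) = hdist z w)}"

definition uhp_topology :: "uhp topology" where
  "uhp_topology = pullback_topology UNIV of_uhp euclidean"

text \<open>The boundary circle is the one-point compactification of the line, with
  \<open>None\<close> playing the role of the point at infinity.\<close>

type_synonym bdry = "real option"

definition bdry_topology :: "bdry topology" where
  "bdry_topology = Alexandroff_compactification euclidean"

text \<open>A frame at a point is an orthonormal basis of the tangent plane for the metric
  \<open>|dz|\<^sup>2 / (Im z)\<^sup>2\<close>; it need not be positively oriented.\<close>

type_synonym frame = "uhp \<times> complex \<times> complex"

definition is_frame :: "frame \<Rightarrow> bool" where
  "is_frame = (\<lambda>(z, v, w). v \<bullet> v = (Im (of_uhp z))\<^sup>2 \<and> w \<bullet> w = (Im (of_uhp z))\<^sup>2 \<and> v \<bullet> w = 0)"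

definition maps_frame :: "(uhp \<Rightarrow> uhp) \<Rightarrow> frame \<Rightarrow> frame \<Rightarrow> bool" where
  "maps_frame A = (\<lambda>(z, v, w) (z', v', w'). A z = z' \<and>
     (\<exists>D. ((\<lambda>\<zeta>. of_uhp (A (Uhp \<zeta>))) has_derivative D) (at (of_uhp z)) \<and> D v = v' \<and> D w = w'))"

subsection \<open>The modular group\<close>

text \<open>The quadruple \<open>(a, b, c, d)\<close> is the matrix with rows \<open>(a, b)\<close> and \<open>(c, d)\<close>.\<close>

type_synonym imat = "int \<times> int \<times> int \<times> int"

definition SL2Z :: "imat set" where
  "SL2Z = {(a, b, c, d). a * d - b * c = 1}"

definition moebius_uhp :: "imat \<Rightarrow> uhp \<Rightarrow> uhp" where
  "moebius_uhp = (\<lambda>(a, b, c, d) z.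
     Uhp ((of_int a * of_uhp z + of_int b) / (of_int c * of_uhp z + of_int d)))"

definition moebius_bdry :: "imat \<Rightarrow> bdry \<Rightarrow> bdry" where
  "moebius_bdry = (\<lambda>(a, b, c, d) t. case t of
       None \<Rightarrow> if c = 0 then None else Some (of_int a / of_int c)
     | Some s \<Rightarrow> if of_int c * s + of_int d = 0 then None
                 else Some ((of_int a * s + of_int b) / (of_int c * s + of_int d)))"

text \<open>The group \<open>PSL(2, \<int>)\<close> is identified with its image in the isometry group: two matrices
  act in the same way iff they agree up to sign (\<open>moebius_eq_iff\<close> below).\<close>

definition PSL2Z :: "(uhp \<Rightarrow> uhp) set" where
  "PSL2Z = moebius_uhp ` SL2Z"

definition elliptic :: "uhp \<Rightarrow> bool" where
  "elliptic z \<longleftrightarrow> (\<exists>g\<in>PSL2Z. g \<noteq> id \<and> g z = z)"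

text \<open>Nonstandard integers, and \<open>PSL(2, *\<int>)\<close> as a set of nonstandard isometries: a matrix of
  determinant \<open>1\<close> over the ring of nonstandard integers acts through the class of the Moebius
  maps of representing sequences of its entries. (For indices outside a set of the
  ultrafilter the representing integer matrices may fail to have determinant \<open>1\<close>; this does
  not affect the class.)\<close>

definition starZ :: "nat filter \<Rightarrow> (nat \<Rightarrow> int) set set" where
  "starZ U = star U UNIV"

definition SL2_starZ ::
    "nat filter \<Rightarrow> ((nat \<Rightarrow> int) set \<times> (nat \<Rightarrow> int) set \<times> (nat \<Rightarrow> int) set \<times> (nat \<Rightarrow> int) set) set" where
  "SL2_starZ U = {(a, b, c, d). a \<in> starZ U \<and> b \<in> starZ U \<and> c \<in> starZ U \<and> d \<in> starZ U
     \<and> star_op U (-) (star_op U (*) a d) (star_op U (*) b c) = star_class U (\<lambda>n. 1)}"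

definition star_moebius :: "nat filter \<Rightarrow>
    (nat \<Rightarrow> int) set \<times> (nat \<Rightarrow> int) set \<times> (nat \<Rightarrow> int) set \<times> (nat \<Rightarrow> int) set \<Rightarrow> (nat \<Rightarrow> uhp \<Rightarrow> uhp) set" where
  "star_moebius U = (\<lambda>(a, b, c, d). {g. \<exists>a'\<in>a. \<exists>b'\<in>b. \<exists>c'\<in>c. \<exists>d'\<in>d.
     eventually (\<lambda>n. g n = moebius_uhp (a' n, b' n, c' n, d' n)) U})"

definition PSL2_starZ :: "nat filter \<Rightarrow> (nat \<Rightarrow> uhp \<Rightarrow> uhp) set set" where
  "PSL2_starZ U = star_moebius U ` SL2_starZ U"

subsection \<open>The suspension and its foliation\<close>

definition act :: "imat \<Rightarrow> uhp \<times> bdry \<Rightarrow> uhp \<times> bdry" where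
  "act M = (\<lambda>(z, t). (moebius_uhp M z, moebius_bdry M t))"

text \<open>Points of the suspension are orbits of the diagonal action.\<close>

type_synonym spoint = "(uhp \<times> bdry) set"

definition spt :: "uhp \<times> bdry \<Rightarrow> spoint" where
  "spt p = (\<lambda>M. act M p) ` SL2Z"

definition suspension :: "spoint set" where
  "suspension = range spt"

definition suspension_topology :: "spoint topology" where
  "suspension_topology = topology (\<lambda>W. W \<subseteq> suspension \<and>
     openin (prod_topology uhp_topology bdry_topology) (spt -` W))"

text \<open>The projection to the modular surface, whose points are the orbits in the plane.\<close>

definition surface_pt :: "uhp \<Rightarrow> uhp set" where
  "surface_pt z = (\<lambda>M. moebius_uhp M z) ` SL2Z"

definition proj :: "spoint \<Rightarrow> uhp set" where
  "proj y = fst ` y"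

definition leaf_cover :: "bdry \<Rightarrow> uhp \<Rightarrow> spoint" where
  "leaf_cover r z = spt (z, r)"

definition leaf :: "bdry \<Rightarrow> spoint set" where
  "leaf r = range (leaf_cover r)"

definition fiber_transversal :: "spoint \<Rightarrow> spoint set" where
  "fiber_transversal x = {y \<in> suspension. proj y = proj x}"

subsection \<open>Frame fields\<close>

text \<open>A frame on the modular surface is an orbit of frames of the plane; a leafwise frame of the
  suspension is an orbit of pairs consisting of a frame of the plane and a boundary point.\<close>

definition surface_frame :: "frame \<Rightarrow> frame set" where
  "surface_frame F = {G. \<exists>M\<in>SL2Z. maps_frame (moebius_uhp M) F G}"

definition surface_frames_at :: "uhp set \<Rightarrow> frame set set" where
  "surface_frames_at p = {surface_frame F | F. is_frame F \<and> surface_pt (fst F) = p}"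

definition leaf_frame :: "frame \<times> bdry \<Rightarrow> (frame \<times> bdry) set" where
  "leaf_frame = (\<lambda>(F, t). {(G, s). \<exists>M\<in>SL2Z. maps_frame (moebius_uhp M) F G \<and> moebius_bdry M t = s})"

definition leaf_frames_at :: "spoint \<Rightarrow> (frame \<times> bdry) set set" where
  "leaf_frames_at y = {leaf_frame (F, t) | F t. is_frame F \<and> spt (fst F, t) = y}"

text \<open>The projection of the suspension restricts to a local isometry from each leaf to the
  modular surface (away from the elliptic points). On leafwise frames it forgets the boundary
  point.\<close>

definition lifted_frame_field ::
    "spoint set \<Rightarrow> frame set \<Rightarrow> (spoint \<Rightarrow> (frame \<times> bdry) set) \<Rightarrow> bool" where
  "lifted_frame_field T \<phi> f \<longleftrightarrow> (\<forall>y\<in>T. f y \<in> leaf_frames_at y \<and> fst ` f y = \<phi>)"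

text \<open>The lift of a frame field along the universal cover \<open>leaf_cover r\<close> of a leaf.\<close>

definition frame_lift :: "bdry \<Rightarrow> (spoint \<Rightarrow> (frame \<times> bdry) set) \<Rightarrow> uhp \<Rightarrow> frame" where
  "frame_lift r f z = (THE F. is_frame F \<and> fst F = z \<and> leaf_frame (F, r) = f (leaf_cover r z))"

subsection \<open>The fundamental germ\<close>

text \<open>Here \<open>xt\<close> is the chosen lift, to the universal cover of the leaf \<open>r\<close>, of the point
  \<open>leaf_cover r xt\<close> of the transversal \<open>T\<close>. Another choice of lift changes all diophantine
  approximations by one fixed right factor, so the germ does not depend on it.\<close>

definition diophantine_approximation ::
    "bdry \<Rightarrow> spoint set \<Rightarrow> (spoint \<Rightarrow> (frame \<times> bdry) set) \<Rightarrow> uhp \<Rightarrow> (nat \<Rightarrow> uhp \<Rightarrow> uhp) \<Rightarrow> bool" where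
  "diophantine_approximation r T f xt A \<longleftrightarrow>
     (\<exists>y yt. (\<forall>n. y n \<in> T \<inter> leaf r)
       \<and> limitin (subtopology suspension_topology T) y (leaf_cover r xt) sequentially
       \<and> (\<forall>n. leaf_cover r (yt n) = y n)
       \<and> (\<forall>n. A n \<in> uhp_isometries \<and> maps_frame (A n) (frame_lift r f xt) (frame_lift r f (yt n))))"

definition fundamental_germ ::
    "nat filter \<Rightarrow> bdry \<Rightarrow> spoint set \<Rightarrow> (spoint \<Rightarrow> (frame \<times> bdry) set) \<Rightarrow> uhp
      \<Rightarrow> (nat \<Rightarrow> uhp \<Rightarrow> uhp) set set" where
  "fundamental_germ U r T f xt =
     {star_class U (\<lambda>n. A n \<circ> inv (B n)) | A B.
        diophantine_approximation r T f xt A \<and> diophantine_approximation r T f xt B}"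

subsection \<open>Basic facts\<close>

lemma openin_suspension_topology:
  "openin suspension_topology W \<longleftrightarrow> W \<subseteq> suspension \<and>
     openin (prod_topology uhp_topology bdry_topology) (spt -` W)"
proof -
  have "istopology (\<lambda>W. W \<subseteq> suspension \<and>
     openin (prod_topology uhp_topology bdry_topology) (spt -` W))"
    unfolding istopology_def by (auto simp: vimage_Union)
  then show ?thesis
    by (simp add: suspension_topology_def)
qed

lemma Im_of_uhp: "0 < Im (of_uhp z)"
  using of_uhp by auto

lemma moebius_denom_nonzero:
  assumes "(a, b, c, d) \<in> SL2Z"
  shows "of_int c * of_uhp z + of_int d \<noteq> 0"
proof
  assume "of_int c * of_uhp z + of_int d = 0"
  then have "Im (of_int c * of_uhp z + of_int d) = 0" "Re (of_int c * of_uhp z + of_int d) = 0"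
    by simp_all
  then have "c = 0" "d = 0" using Im_of_uhp[of z] by auto
  then show False using assms by (auto simp: SL2Z_def)
qed

lemma of_uhp_moebius:
  assumes "(a, b, c, d) \<in> SL2Z"
  shows "of_uhp (moebius_uhp (a, b, c, d) z)
     = (of_int a * of_uhp z + of_int b) / (of_int c * of_uhp z + of_int d)"
proof -
  let ?w = "of_uhp z"
  let ?D = "of_int c * ?w + of_int d"
  have det: "real_of_int a * real_of_int d - real_of_int b * real_of_int c = 1"
    using assms by (simp add: SL2Z_def flip: of_int_mult of_int_diff)
  have "Im ((of_int a * ?w + of_int b) / ?D)
      = ((real_of_int a * real_of_int d - real_of_int b * real_of_int c) * Im ?w) / (cmod ?D)\<^sup>2"
    by (simp add: Im_divide cmod_power2 field_simps)
  also have "\<dots> > 0"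
    using moebius_denom_nonzero[OF assms, of z] Im_of_uhp[of z] det by simp
  finally show ?thesis
    unfolding moebius_uhp_def by (simp add: Uhp_inverse)
qed

lemma moebius_eq_iff:
  assumes M: "(a, b, c, d) \<in> SL2Z" and N: "(a', b', c', d') \<in> SL2Z"
  shows "moebius_uhp (a, b, c, d) = moebius_uhp (a', b', c', d') \<longleftrightarrow>
     (a', b', c', d') = (a, b, c, d) \<or> (a', b', c', d') = (-a, -b, -c, -d)"
proof
  assume eq: "moebius_uhp (a, b, c, d) = moebius_uhp (a', b', c', d')"
  have cross: "(of_int a * w + of_int b) * (of_int c' * w + of_int d')
      = (of_int a' * w + of_int b') * (of_int c * w + of_int d)" if "0 < Im w" for w :: complex
  proof -
    have w: "of_uhp (Uhp w) = w" using that by (simp add: Uhp_inverse)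
    have "of_uhp (moebius_uhp (a, b, c, d) (Uhp w)) = of_uhp (moebius_uhp (a', b', c', d') (Uhp w))"
      using eq by simp
    then show ?thesis
      using moebius_denom_nonzero[OF M, of "Uhp w"] moebius_denom_nonzero[OF N, of "Uhp w"]
      by (simp add: of_uhp_moebius[OF M] of_uhp_moebius[OF N] w frac_eq_eq)
  qed
  have *: "real_of_int (b * d' - t\<^sup>2 * (a * c')) = real_of_int (b' * d - t\<^sup>2 * (a' * c))
      \<and> real_of_int (t * (a * d' + b * c')) = real_of_int (t * (a' * d + b' * c))" if "0 < t" for t :: int
    using cross[of "Complex 0 (of_int t)"] that
    by (auto simp: complex_eq_iff power2_eq_square algebra_simps)
  have e: "b * d' - a * c' = b' * d - a' * c" "b * d' - 4 * (a * c') = b' * d - 4 * (a' * c)"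
      "a * d' + b * c' = a' * d + b' * c"
    using *[of 1] *[of 2] by (simp_all only: of_int_eq_iff) simp_all
  then have ac: "a * c' = a' * c" and bd: "b * d' = b' * d" by linarith+
  have dM: "a * d - b * c = 1" and dN: "a' * d' - b' * c' = 1"
    using M N by (auto simp: SL2Z_def)
  define k where "k = a' * d - b * c'"
  have "a' = a' * (a * d - b * c)" "b' = b' * (a * d - b * c)"
       "c' = c' * (a * d - b * c)" "d' = d' * (a * d - b * c)"
    using dM by simp_all
  then have k: "a' = k * a" "b' = k * b" "c' = k * c" "d' = k * d"
    using ac bd e(3) unfolding k_def by algebra+
  then have "k * k * (a * d - b * c) = 1"
    using dN by (simp add: algebra_simps)
  then have "k = 1 \<or> k = -1"
    using dM by (simp add: zmult_eq_1_iff)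
  then show "(a', b', c', d') = (a, b, c, d) \<or> (a', b', c', d') = (-a, -b, -c, -d)"
    using k by auto
next
  assume "(a', b', c', d') = (a, b, c, d) \<or> (a', b', c', d') = (-a, -b, -c, -d)"
  then show "moebius_uhp (a, b, c, d) = moebius_uhp (a', b', c', d')"
  proof
    assume "(a', b', c', d') = (-a, -b, -c, -d)"
    moreover have "(- w - u) / (- v - x) = (w + u) / (v + x)" for u v w x :: complex
      using minus_divide_divide[of "w + u" "v + x"] by simp
    ultimately show ?thesis by (simp add: moebius_uhp_def fun_eq_iff add.commute)
  qed simp
qed

lemma star_moebius_class:
  "star_moebius U (star_class U a, star_class U b, star_class U c, star_class U d)
     = star_class U (\<lambda>n. moebius_uhp (a n, b n, c n, d n))"
proof -
  have "eventually (\<lambda>n. moebius_uhp (a n, b n, c n, d n) = g n) U"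
    if "eventually (\<lambda>n. a n = a' n) U" "eventually (\<lambda>n. b n = b' n) U"
       "eventually (\<lambda>n. c n = c' n) U" "eventually (\<lambda>n. d n = d' n) U"
       "eventually (\<lambda>n. g n = moebius_uhp (a' n, b' n, c' n, d' n)) U" for a' b' c' d' g
    using that by eventually_elim simp
  moreover have "g \<in> star_moebius U (star_class U a, star_class U b, star_class U c, star_class U d)"
    if "eventually (\<lambda>n. moebius_uhp (a n, b n, c n, d n) = g n) U" for g
    unfolding star_moebius_def prod.case mem_Collect_eq
    using that
    by (intro bexI[of _ a] bexI[of _ b] bexI[of _ c] bexI[of _ d]) (auto simp: star_class_def eq_commute)
  ultimately show ?thesis
    by (fastforce simp: star_moebius_def star_class_def)
qed

lemma star_class_eq_iff: "star_class U x = star_class U y \<longleftrightarrow> eventually (\<lambda>n. x n = y n) U"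
proof
  assume "star_class U x = star_class U y"
  then have "y \<in> star_class U x" by (simp add: star_class_def)
  then show "eventually (\<lambda>n. x n = y n) U" by (simp add: star_class_def)
next
  assume *: "eventually (\<lambda>n. x n = y n) U"
  have "eventually (\<lambda>n. x n = z n) U \<longleftrightarrow> eventually (\<lambda>n. y n = z n) U" for z
    by (rule eventually_cong[OF *]) simp
  then show "star_class U x = star_class U y" by (simp add: star_class_def)
qed

lemma starZ_iff: "A \<in> starZ U \<longleftrightarrow> (\<exists>a. A = star_class U a)"
  by (simp add: starZ_def star_def)

lemma SL2_starZ_class_iff:
  "(star_class U a, star_class U b, star_class U c, star_class U d) \<in> SL2_starZ U
     \<longleftrightarrow> eventually (\<lambda>n. (a n, b n, c n, d n) \<in> SL2Z) U"
proof -
  have "star_class U a \<in> starZ U" for a by (auto simp: starZ_iff)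
  then show ?thesis
    by (simp add: SL2_starZ_def star_op_class star_class_eq_iff SL2Z_def)
qed

text \<open>The two descriptions of the nonstandard modular group agree.\<close>

lemma PSL2_starZ_eq_star: "PSL2_starZ U = star U PSL2Z"
proof
  show "PSL2_starZ U \<subseteq> star U PSL2Z"
  proof
    fix G assume "G \<in> PSL2_starZ U"
    then obtain A B C D where S': "(A, B, C, D) \<in> SL2_starZ U" and G': "G = star_moebius U (A, B, C, D)"
      by (auto simp: PSL2_starZ_def)
    from S' have "A \<in> starZ U" "B \<in> starZ U" "C \<in> starZ U" "D \<in> starZ U"
      by (auto simp: SL2_starZ_def)
    then obtain a b c d where cl: "A = star_class U a" "B = star_class U b"
        "C = star_class U c" "D = star_class U d"
      unfolding starZ_iff by blast
    have S: "(star_class U a, star_class U b, star_class U c, star_class U d) \<in> SL2_starZ U"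
      and G: "G = star_class U (\<lambda>n. moebius_uhp (a n, b n, c n, d n))"
      using S' G' by (simp_all add: cl star_moebius_class)
    from S have ev: "eventually (\<lambda>n. (a n, b n, c n, d n) \<in> SL2Z) U"
      by (simp add: SL2_starZ_class_iff)
    define g where "g n = (if (a n, b n, c n, d n) \<in> SL2Z then moebius_uhp (a n, b n, c n, d n)
                            else moebius_uhp (1, 0, 0, 1))" for n
    have "g n \<in> PSL2Z" for n
      by (auto simp: g_def PSL2Z_def SL2Z_def)
    moreover have "G = star_class U g"
      unfolding G star_class_eq_iff using ev by eventually_elim (simp add: g_def)
    ultimately show "G \<in> star U PSL2Z" by (auto simp: star_def)
  qed
next
  show "star U PSL2Z \<subseteq> PSL2_starZ U"
  proof
    fix G assume "G \<in> star U PSL2Z"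
    then obtain g where G: "G = star_class U g" and "\<forall>n. g n \<in> PSL2Z" by (auto simp: star_def)
    then have "\<forall>n. \<exists>M. M \<in> SL2Z \<and> g n = moebius_uhp M" unfolding PSL2Z_def by blast
    then obtain M where M: "\<And>n. M n \<in> SL2Z" "\<And>n. g n = moebius_uhp (M n)" by metis
    define a b c d where "a n = fst (M n)" and "b n = fst (snd (M n))"
      and "c n = fst (snd (snd (M n)))" and "d n = snd (snd (snd (M n)))" for n
    have Mn: "M n = (a n, b n, c n, d n)" for n by (simp add: a_def b_def c_def d_def)
    have "(star_class U a, star_class U b, star_class U c, star_class U d) \<in> SL2_starZ U"
      using M(1) by (simp add: SL2_starZ_class_iff flip: Mn)
    moreover have "star_moebius U (star_class U a, star_class U b, star_class U c, star_class U d) = G"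
      by (simp add: star_moebius_class G M(2)[abs_def] flip: Mn)
    ultimately show "G \<in> PSL2_starZ U" unfolding PSL2_starZ_def by (rule image_eqI[rotated, OF _ sym])
  qed
qed

end

theory Submission
  imports Defs
begin

text \<open>
  The leaf through \<open>(xt, 0)\<close> meets the fiber transversal in the points with lifts \<open>\<gamma> xt\<close>, for \<open>\<gamma>\<close> in the
  modular group. All frames of the field lie over one frame of the modular surface, and \<open>xt\<close> is
  not elliptic, so the lifted field is equivariant along the orbit: \<open>\<gamma>\<close> itself takes the lifted
  frame at \<open>xt\<close> to the one at \<open>\<gamma> xt\<close> (\<open>frame_lift_equivariant\<close>). An isometry of the plane is
  determined by its effect on one frame (\<open>isometry_determined_by_frame\<close>). Hence every
  diophantine approximation is a sequence in the modular group, and its quotients \<open>A B\<^sup>-\<^sup>1\<close> are too.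
  This is the inclusion of the germ in the nonstandard modular group.

  For the reverse inclusion, the point of the leaf under \<open>\<gamma> xt\<close> is also the point under
  \<open>(xt, \<gamma>\<^sup>-\<^sup>1 0)\<close>, so a sequence \<open>\<gamma>\<^sub>n\<close> is a diophantine approximation as soon as \<open>\<gamma>\<^sub>n\<^sup>-\<^sup>1 0\<close> tends to \<open>0\<close>
  (\<open>diophantine_approximationI\<close>). An arbitrary sequence \<open>g\<^sub>n\<close> must then be written as
  \<open>A\<^sub>n B\<^sub>n\<^sup>-\<^sup>1\<close> with two such sequences. Parabolic elements \<open>p\<^sub>n\<close> fixing \<open>0\<close> achieve this: a large power of the
  shear \<open>t \<mapsto> t / (t + 1)\<close> moves any prescribed boundary point close to \<open>0\<close>, so \<open>p\<^sub>n\<close> can be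
  chosen with \<open>p\<^sub>n g\<^sub>n 0\<close> tending to \<open>0\<close> (\<open>shear_contracts_to_zero\<close>), and then
  \<open>A\<^sub>n = p\<^sub>n\<^sup>-\<^sup>1\<close> and \<open>B\<^sub>n = (p\<^sub>n g\<^sub>n)\<^sup>-\<^sup>1\<close> do it.
\<close>

section \<open>The modular group acting on the plane and on its boundary\<close>

definition mat_mult :: "imat \<Rightarrow> imat \<Rightarrow> imat" where
  "mat_mult = (\<lambda>(a, b, c, d) (a', b', c', d').
     (a * a' + b * c', a * b' + b * d', c * a' + d * c', c * b' + d * d'))"

definition mat_adj :: "imat \<Rightarrow> imat" where
  "mat_adj = (\<lambda>(a, b, c, d). (d, - b, - c, a))"

lemma one_in_SL2Z: "(1, 0, 0, 1) \<in> SL2Z"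
  by (simp add: SL2Z_def)

lemma mat_mult_in_SL2Z:
  assumes "M \<in> SL2Z" "N \<in> SL2Z"
  shows "mat_mult M N \<in> SL2Z"
proof -
  obtain a b c d a' b' c' d' where M: "M = (a, b, c, d)" and N: "N = (a', b', c', d')"
    by (metis prod_cases4)
  have "a * d - b * c = 1" "a' * d' - b' * c' = 1"
    using assms by (auto simp: M N SL2Z_def)
  then have "(a * a' + b * c') * (c * b' + d * d') - (a * b' + b * d') * (c * a' + d * c') = 1"
    by algebra
  then show ?thesis by (simp add: M N mat_mult_def SL2Z_def)
qed

lemma mat_adj_in_SL2Z: "M \<in> SL2Z \<Longrightarrow> mat_adj M \<in> SL2Z"
  by (auto simp: mat_adj_def SL2Z_def algebra_simps)

lemma mat_adj_left_inverse: "M \<in> SL2Z \<Longrightarrow> mat_mult (mat_adj M) M = (1, 0, 0, 1)"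
  by (auto simp: mat_mult_def mat_adj_def SL2Z_def algebra_simps)

lemma mat_adj_right_inverse: "M \<in> SL2Z \<Longrightarrow> mat_mult M (mat_adj M) = (1, 0, 0, 1)"
  by (auto simp: mat_mult_def mat_adj_def SL2Z_def algebra_simps)

lemma moebius_uhp_one: "moebius_uhp (1, 0, 0, 1) z = z"
  by (simp add: moebius_uhp_def of_uhp_inverse)

lemma moebius_uhp_mult:
  assumes "M \<in> SL2Z" "N \<in> SL2Z"
  shows "moebius_uhp (mat_mult M N) z = moebius_uhp M (moebius_uhp N z)"
proof -
  obtain a b c d a' b' c' d' where M: "M = (a, b, c, d)" and N: "N = (a', b', c', d')"
    by (metis prod_cases4)
  let ?w = "of_uhp z"
  let ?D = "of_int c' * ?w + of_int d'"
  have MN: "(a * a' + b * c', a * b' + b * d', c * a' + d * c', c * b' + d * d') \<in> SL2Z"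
    using mat_mult_in_SL2Z[OF assms] by (simp add: M N mat_mult_def)
  have D: "?D \<noteq> 0" using moebius_denom_nonzero assms(2) N by blast
  have over_D: "u * (p / ?D) + v = (u * p + v * ?D) / ?D" for u v p
    using D by (simp add: add_divide_distrib)
  have "of_uhp (moebius_uhp M (moebius_uhp N z))
      = (of_int a * ((of_int a' * ?w + of_int b') / ?D) + of_int b)
          / (of_int c * ((of_int a' * ?w + of_int b') / ?D) + of_int d)"
    using assms by (simp add: M N of_uhp_moebius)
  also have "\<dots> = ((of_int a * (of_int a' * ?w + of_int b') + of_int b * ?D) / ?D)
      / ((of_int c * (of_int a' * ?w + of_int b') + of_int d * ?D) / ?D)"
    by (simp only: over_D)
  also have "\<dots> = (of_int a * (of_int a' * ?w + of_int b') + of_int b * ?D)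
      / (of_int c * (of_int a' * ?w + of_int b') + of_int d * ?D)"
    using D by simp
  also have "\<dots> = of_uhp (moebius_uhp (mat_mult M N) z)"
    using MN by (simp add: M N mat_mult_def of_uhp_moebius algebra_simps)
  finally show ?thesis by (simp add: of_uhp_inject)
qed

lemma moebius_uhp_adj_left: "M \<in> SL2Z \<Longrightarrow> moebius_uhp (mat_adj M) (moebius_uhp M z) = z"
  by (simp add: moebius_uhp_one mat_adj_in_SL2Z mat_adj_left_inverse flip: moebius_uhp_mult)

lemma moebius_uhp_adj_right: "M \<in> SL2Z \<Longrightarrow> moebius_uhp M (moebius_uhp (mat_adj M) z) = z"
  by (simp add: moebius_uhp_one mat_adj_in_SL2Z mat_adj_right_inverse flip: moebius_uhp_mult)

lemma bij_moebius_uhp: "M \<in> SL2Z \<Longrightarrow> bij (moebius_uhp M)"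
  by (rule o_bij[where g = "moebius_uhp (mat_adj M)"])
     (auto simp: fun_eq_iff moebius_uhp_adj_left moebius_uhp_adj_right)

lemma inv_moebius_uhp: "M \<in> SL2Z \<Longrightarrow> inv (moebius_uhp M) = moebius_uhp (mat_adj M)"
  by (rule inv_equality) (auto simp: moebius_uhp_adj_left moebius_uhp_adj_right)

lemma PSL2Z_compose_inv:
  assumes "g \<in> PSL2Z" "h \<in> PSL2Z"
  shows "g \<circ> inv h \<in> PSL2Z"
proof -
  obtain M N where M: "M \<in> SL2Z" "g = moebius_uhp M" and N: "N \<in> SL2Z" "h = moebius_uhp N"
    using assms by (auto simp: PSL2Z_def)
  have "g \<circ> inv h = moebius_uhp (mat_mult M (mat_adj N))"
    unfolding M(2) N(2) using M(1) N(1)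
    by (simp add: inv_moebius_uhp fun_eq_iff moebius_uhp_mult mat_adj_in_SL2Z)
  then show ?thesis
    using M N by (simp add: PSL2Z_def mat_adj_in_SL2Z mat_mult_in_SL2Z)
qed

text \<open>Homogeneous coordinates on the boundary: there the action is linear, and the case distinctions
  at infinity disappear from the composition law.\<close>

definition bdry_pt :: "real \<Rightarrow> real \<Rightarrow> bdry" where
  "bdry_pt p q = (if q = 0 then None else Some (p / q))"

lemma bdry_pt_exhausts:
  obtains p q where "t = bdry_pt p q" "(p, q) \<noteq> (0, 0)"
proof (cases t)
  case None
  then show ?thesis using that[of 1 0] by (simp add: bdry_pt_def)
next
  case (Some s)
  then show ?thesis using that[of s 1] by (simp add: bdry_pt_def)
qed

lemma moebius_bdry_pt:
  assumes "(p, q) \<noteq> (0, 0)"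
  shows "moebius_bdry (a, b, c, d) (bdry_pt p q)
     = bdry_pt (of_int a * p + of_int b * q) (of_int c * p + of_int d * q)"
proof (cases "q = 0")
  case True
  then show ?thesis using assms by (simp add: moebius_bdry_def bdry_pt_def)
next
  case False
  have num: "of_int a * (p / q) + of_int b = (of_int a * p + of_int b * q) / q"
    and den: "of_int c * (p / q) + of_int d = (of_int c * p + of_int d * q) / q"
    using False by (simp_all add: add_divide_distrib)
  have "bdry_pt p q = Some (p / q)" using False by (simp add: bdry_pt_def)
  then show ?thesis
    using False by (simp only: moebius_bdry_def prod.case option.case num den) (simp add: bdry_pt_def)
qed

lemma moebius_bdry_one: "moebius_bdry (1, 0, 0, 1) t = t"
  by (simp add: moebius_bdry_def split: option.split)

lemma moebius_bdry_mult:
  assumes "M \<in> SL2Z" "N \<in> SL2Z"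
  shows "moebius_bdry (mat_mult M N) t = moebius_bdry M (moebius_bdry N t)"
proof -
  obtain a b c d a' b' c' d' where M: "M = (a, b, c, d)" and N: "N = (a', b', c', d')"
    by (metis prod_cases4)
  obtain p q where t: "t = bdry_pt p q" and pq: "(p, q) \<noteq> (0, 0)"
    by (rule bdry_pt_exhausts)
  have det: "real_of_int a' * of_int d' - of_int b' * of_int c' = 1"
    using assms by (simp add: N SL2Z_def flip: of_int_mult of_int_diff)
  let ?p = "of_int a' * p + of_int b' * q" and ?q = "of_int c' * p + of_int d' * q"
  have "p = of_int d' * ?p - of_int b' * ?q" "q = of_int a' * ?q - of_int c' * ?p"
    using det by algebra+
  then have "(?p, ?q) \<noteq> (0, 0)" using pq by (metis diff_self mult_zero_right prod.inject)
  then show ?thesis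
    using pq by (simp add: M N t mat_mult_def moebius_bdry_pt algebra_simps)
qed

section \<open>Orbits in the suspension\<close>

lemma act_one: "act (1, 0, 0, 1) p = p"
  by (cases p) (simp add: act_def moebius_uhp_one moebius_bdry_one)

lemma act_mult:
  assumes "M \<in> SL2Z" "N \<in> SL2Z"
  shows "act (mat_mult M N) p = act M (act N p)"
  using assms by (cases p) (simp add: act_def moebius_uhp_mult moebius_bdry_mult)

lemma mem_spt_self: "p \<in> spt p"
  unfolding spt_def using act_one one_in_SL2Z by (metis imageI)

lemma spt_act:
  assumes "M \<in> SL2Z"
  shows "spt (act M p) = spt p"
proof
  show "spt (act M p) \<subseteq> spt p"
    unfolding spt_def using assms by (auto simp flip: act_mult intro: mat_mult_in_SL2Z)
  have "act N p = act (mat_mult N (mat_adj M)) (act M p)" if "N \<in> SL2Z" for N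
    using that assms
    by (simp add: act_mult mat_adj_in_SL2Z)
       (simp add: mat_adj_in_SL2Z mat_adj_left_inverse act_one flip: act_mult)
  then show "spt p \<subseteq> spt (act M p)"
    unfolding spt_def using assms by (blast intro: mat_mult_in_SL2Z mat_adj_in_SL2Z)
qed

text \<open>Moving a point of the leaf along the orbit in the plane amounts to staying at \<open>z\<close> and moving the
  boundary parameter by the inverse element; this is how points of the leaf accumulate in the fiber.\<close>

lemma spt_moebius_uhp:
  assumes "M \<in> SL2Z"
  shows "spt (moebius_uhp M z, t) = spt (z, moebius_bdry (mat_adj M) t)"
  using spt_act[OF mat_adj_in_SL2Z[OF assms], of "(moebius_uhp M z, t)"] assms
  by (simp add: act_def moebius_uhp_adj_left)

lemma proj_spt: "proj (spt (z, t)) = surface_pt z"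
  by (auto simp: proj_def spt_def surface_pt_def act_def image_image)

lemma mem_surface_pt_self: "z \<in> surface_pt z"
  unfolding surface_pt_def using moebius_uhp_one one_in_SL2Z by (metis imageI)

lemma surface_pt_moebius: "M \<in> SL2Z \<Longrightarrow> surface_pt (moebius_uhp M z) = surface_pt z"
  using spt_moebius_uhp[of M z None] by (metis proj_spt)

lemma continuous_map_spt:
  "continuous_map (prod_topology uhp_topology bdry_topology) suspension_topology spt"
proof -
  have top: "topspace (prod_topology uhp_topology bdry_topology) = UNIV"
    by (simp add: uhp_topology_def bdry_topology_def topspace_pullback_topology
        flip: UNIV_option_conv)
  then have "openin (prod_topology uhp_topology bdry_topology) (spt -` suspension)"
    using openin_topspace[of "prod_topology uhp_topology bdry_topology"]
    by (simp add: suspension_def vimage_def)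
  then have "topspace suspension_topology = suspension"
    by (intro antisym openin_subset)
       (auto simp: openin_suspension_topology topspace_def)
  then show ?thesis
    unfolding continuous_map_def top
    by (auto simp: openin_suspension_topology suspension_def vimage_def)
qed

text \<open>Convergence inside a fiber is implied by convergence of the boundary parameters, because the
  orbit map is continuous.\<close>

lemma limitin_spt_bdry:
  assumes "s \<longlonglongrightarrow> l"
  shows "limitin suspension_topology (\<lambda>n. spt (z, Some (s n))) (spt (z, Some l)) sequentially"
proof -
  have "continuous_map euclideanreal (prod_topology uhp_topology bdry_topology) (\<lambda>r. (z, Some r))"
    unfolding bdry_topology_def
    by (intro continuous_map_pairedI continuous_map_Some)
       (simp add: uhp_topology_def topspace_pullback_topology)
  then have "continuous_map euclideanreal suspension_topology (spt \<circ> (\<lambda>r. (z, Some r)))"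
    using continuous_map_spt by (rule continuous_map_compose)
  moreover have "limitin euclideanreal s l sequentially" using assms by simp
  ultimately show ?thesis
    using continuous_map_limit by (fastforce simp: o_def)
qed

section \<open>Isometries and frames\<close>

lemma Im_moebius:
  assumes "(a, b, c, d) \<in> SL2Z"
  shows "Im (of_uhp (moebius_uhp (a, b, c, d) z))
     = Im (of_uhp z) / (cmod (of_int c * of_uhp z + of_int d))\<^sup>2"
proof -
  let ?w = "of_uhp z"
  have det: "real_of_int a * of_int d - of_int b * of_int c = 1"
    using assms by (simp add: SL2Z_def flip: of_int_mult of_int_diff)
  have "Im (of_uhp (moebius_uhp (a, b, c, d) z))
      = ((real_of_int a * of_int d - of_int b * of_int c) * Im ?w)
          / (cmod (of_int c * ?w + of_int d))\<^sup>2"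
    by (simp add: of_uhp_moebius[OF assms] Im_divide cmod_power2 field_simps)
  then show ?thesis by (simp add: det)
qed

lemma moebius_isometry:
  assumes "M \<in> SL2Z"
  shows "moebius_uhp M \<in> uhp_isometries"
proof -
  obtain a b c d where M: "M = (a, b, c, d)" by (metis prod_cases4)
  have det: "complex_of_int a * of_int d - of_int b * of_int c = 1"
    using assms by (simp add: M SL2Z_def flip: of_int_mult of_int_diff)
  note Im = Im_moebius[OF assms[unfolded M], folded M]
  have "hdist (moebius_uhp M z) (moebius_uhp M w) = hdist z w" for z w
  proof -
    let ?z = "of_uhp z" and ?w = "of_uhp w"
    let ?D = "of_int c * ?z + of_int d" and ?E = "of_int c * ?w + of_int d"
    have D: "?D \<noteq> 0" "?E \<noteq> 0" using moebius_denom_nonzero assms M by blast+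
    have "of_uhp (moebius_uhp M z) - of_uhp (moebius_uhp M w)
        = ((of_int a * ?z + of_int b) * ?E - (of_int a * ?w + of_int b) * ?D) / (?D * ?E)"
      using D assms by (simp add: M of_uhp_moebius diff_frac_eq)
    also have "(of_int a * ?z + of_int b) * ?E - (of_int a * ?w + of_int b) * ?D = ?z - ?w"
      using det by algebra
    finally have "(cmod (of_uhp (moebius_uhp M z) - of_uhp (moebius_uhp M w)))\<^sup>2
        = (cmod (?z - ?w))\<^sup>2 / ((cmod ?D)\<^sup>2 * (cmod ?E)\<^sup>2)"
      by (simp add: norm_divide norm_mult power_divide power_mult_distrib)
    then show ?thesis using D by (simp add: hdist_def Im)
  qed
  then show ?thesis using bij_moebius_uhp[OF assms] by (simp add: uhp_isometries_def)
qed

lemma open_upper_half_plane: "open {\<zeta>. 0 < Im \<zeta>}"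
  by (simp add: open_halfspace_Im_gt)

lemma maps_frameI:
  assumes "A z = z'" "((\<lambda>\<zeta>. of_uhp (A (Uhp \<zeta>))) has_derivative D) (at (of_uhp z))"
  shows "maps_frame A (z, v, w) (z', D v, D w)"
  using assms by (auto simp: maps_frame_def)

lemma maps_frame_unique:
  assumes "maps_frame A F G" "maps_frame A F H"
  shows "G = H"
proof -
  obtain z v w where F: "F = (z, v, w)" by (metis prod_cases3)
  obtain z1 v1 w1 where G: "G = (z1, v1, w1)" by (metis prod_cases3)
  obtain z2 v2 w2 where H: "H = (z2, v2, w2)" by (metis prod_cases3)
  obtain D where D: "A z = z1" "D v = v1" "D w = w1"
      "((\<lambda>\<zeta>. of_uhp (A (Uhp \<zeta>))) has_derivative D) (at (of_uhp z))"
    using assms(1) by (auto simp: F G maps_frame_def)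
  obtain E where E: "A z = z2" "E v = v2" "E w = w2"
      "((\<lambda>\<zeta>. of_uhp (A (Uhp \<zeta>))) has_derivative E) (at (of_uhp z))"
    using assms(2) by (auto simp: F H maps_frame_def)
  have "D = E" using D(4) E(4) by (rule has_derivative_unique)
  then show ?thesis using D E by (simp add: G H)
qed

lemma maps_frame_fst: "maps_frame A F G \<Longrightarrow> A (fst F) = fst G"
  by (auto simp: maps_frame_def split: prod.splits)

lemma maps_frame_id: "maps_frame id F F"
proof -
  obtain z v w where F: "F = (z, v, w)" by (metis prod_cases3)
  have "((\<lambda>\<zeta>. of_uhp (id (Uhp \<zeta>))) has_derivative (\<lambda>h. h)) (at (of_uhp z))"
    by (rule has_derivative_transform_within_open[OF has_derivative_ident open_upper_half_plane])
       (auto simp: Im_of_uhp Uhp_inverse)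
  from maps_frameI[OF _ this, of z v w] show ?thesis by (simp add: F id_def)
qed

lemma maps_frame_compose:
  assumes "maps_frame A F G" "maps_frame B G H"
  shows "maps_frame (B \<circ> A) F H"
proof -
  obtain z v w where F: "F = (z, v, w)" by (metis prod_cases3)
  obtain z1 v1 w1 where G: "G = (z1, v1, w1)" by (metis prod_cases3)
  obtain z2 v2 w2 where H: "H = (z2, v2, w2)" by (metis prod_cases3)
  from assms(1) obtain D where D: "A z = z1" "D v = v1" "D w = w1"
      "((\<lambda>\<zeta>. of_uhp (A (Uhp \<zeta>))) has_derivative D) (at (of_uhp z))"
    by (auto simp: maps_frame_def F G)
  from assms(2) obtain E where E: "B z1 = z2" "E v1 = v2" "E w1 = w2"
      "((\<lambda>\<zeta>. of_uhp (B (Uhp \<zeta>))) has_derivative E) (at (of_uhp z1))"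
    by (auto simp: maps_frame_def G H)
  have "of_uhp z1 = of_uhp (A (Uhp (of_uhp z)))" using D(1) by (simp add: of_uhp_inverse)
  with E(4) have "((\<lambda>\<zeta>. of_uhp (B (Uhp \<zeta>))) \<circ> (\<lambda>\<zeta>. of_uhp (A (Uhp \<zeta>))) has_derivative E \<circ> D)
      (at (of_uhp z))"
    by (intro diff_chain_at[OF D(4)]) simp
  then have "((\<lambda>\<zeta>. of_uhp ((B \<circ> A) (Uhp \<zeta>))) has_derivative E \<circ> D) (at (of_uhp z))"
    by (simp add: o_def of_uhp_inverse)
  from maps_frameI[OF _ this, of z2 v w] show ?thesis using D E by (simp add: F H o_def)
qed

text \<open>The derivative of a modular transformation at \<open>z\<close> is multiplication by \<open>(c z + d)\<^sup>-\<^sup>2\<close>. It is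
  conformal, and its modulus is exactly the ratio of the imaginary parts, so frames go to frames.\<close>

lemma moebius_maps_frame:
  assumes "M \<in> SL2Z" "is_frame F"
  obtains G where "is_frame G" "maps_frame (moebius_uhp M) F G"
proof -
  obtain a b c d where M: "M = (a, b, c, d)" by (metis prod_cases4)
  obtain z v w where F: "F = (z, v, w)" by (metis prod_cases3)
  let ?z = "of_uhp z"
  let ?k = "1 / (of_int c * ?z + of_int d)\<^sup>2"
  have det: "complex_of_int a * of_int d - of_int b * of_int c = 1"
    using assms by (simp add: M SL2Z_def flip: of_int_mult of_int_diff)
  have nz: "of_int c * \<zeta> + of_int d \<noteq> 0" if "0 < Im \<zeta>" for \<zeta>
    using moebius_denom_nonzero[of a b c d "Uhp \<zeta>"] assms that by (simp add: M Uhp_inverse)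
  have "((\<lambda>\<zeta>. (of_int a * \<zeta> + of_int b) / (of_int c * \<zeta> + of_int d)) has_field_derivative
      (of_int a * (of_int c * ?z + of_int d) - (of_int a * ?z + of_int b) * of_int c)
        / ((of_int c * ?z + of_int d) * (of_int c * ?z + of_int d))) (at ?z)"
    using nz[OF Im_of_uhp] by (auto intro!: derivative_eq_intros)
  also have "(of_int a * (of_int c * ?z + of_int d) - (of_int a * ?z + of_int b) * of_int c)
      / ((of_int c * ?z + of_int d) * (of_int c * ?z + of_int d)) = ?k"
  proof -
    have "of_int a * (of_int c * ?z + of_int d) - (of_int a * ?z + of_int b) * of_int c = 1"
      using det by algebra
    then show ?thesis by (simp add: power2_eq_square)
  qed
  finally have "((\<lambda>\<zeta>. of_uhp (moebius_uhp M (Uhp \<zeta>))) has_field_derivative ?k) (at ?z)"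
    by (rule has_field_derivative_transform_within_open[OF _ open_upper_half_plane])
       (use assms in \<open>auto simp: Im_of_uhp M of_uhp_moebius Uhp_inverse\<close>)
  then have D: "((\<lambda>\<zeta>. of_uhp (moebius_uhp M (Uhp \<zeta>))) has_derivative (\<lambda>h. ?k * h)) (at ?z)"
    by (simp only: has_field_derivative_def)
  have inner_k: "(?k * x) \<bullet> (?k * y) = (x \<bullet> y) * (cmod ?k)\<^sup>2" for x y
    unfolding inner_complex_def cmod_power2 times_complex.sel
    by algebra
  have "(cmod ?k)\<^sup>2 * (Im ?z)\<^sup>2 = (Im (of_uhp (moebius_uhp M z)))\<^sup>2"
    using assms(1) by (simp add: M Im_moebius norm_divide norm_power power_divide)
  then have "is_frame (moebius_uhp M z, ?k * v, ?k * w)"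
    using assms(2) unfolding F is_frame_def prod.case inner_k by (simp add: mult.commute)
  then show ?thesis using that maps_frameI[OF refl D] F by blast
qed

lemma frame_span:
  assumes "is_frame (z, v, w)"
  shows "span {v, w} = UNIV"
proof -
  have vw: "v \<bullet> v > 0" "w \<bullet> w > 0" "v \<bullet> w = 0"
    using assms Im_of_uhp[of z] by (auto simp: is_frame_def)
  then have nz: "v \<noteq> 0" "w \<noteq> 0" "v \<noteq> w" by auto
  have "pairwise orthogonal {v, w}"
    using vw by (auto simp: pairwise_def orthogonal_def inner_commute)
  then have "independent {v, w}"
    by (rule pairwise_orthogonal_independent) (use nz in auto)
  moreover have "card {v, w} = dim (UNIV :: complex set)"
    using nz by simp
  ultimately show ?thesis
    using card_eq_dim[of "{v, w}" UNIV] by auto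
qed

text \<open>Distances are compared through \<open>2 (cosh d - 1)\<close>, which is smooth in both points, unlike the
  distance itself.\<close>

lemma hdist_eq_iff:
  "hdist z w = hdist z' w' \<longleftrightarrow>
     (cmod (of_uhp z - of_uhp w))\<^sup>2 / (Im (of_uhp z) * Im (of_uhp w))
       = (cmod (of_uhp z' - of_uhp w'))\<^sup>2 / (Im (of_uhp z') * Im (of_uhp w'))"
proof -
  have pos: "0 \<le> (cmod (of_uhp z - of_uhp w))\<^sup>2 / (2 * Im (of_uhp z) * Im (of_uhp w))" for z w
    using Im_of_uhp[of z] Im_of_uhp[of w] by simp
  have inj: "arcosh (1 + p) = arcosh (1 + q) \<longleftrightarrow> p = q" if "0 \<le> p" "0 \<le> q" for p q :: real
    using that cosh_arcosh_real[of "1 + p"] cosh_arcosh_real[of "1 + q"]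
    by (metis add_le_cancel_left add.right_neutral add_left_cancel)
  have "hdist z w = hdist z' w' \<longleftrightarrow>
     (cmod (of_uhp z - of_uhp w))\<^sup>2 / (2 * Im (of_uhp z) * Im (of_uhp w))
       = (cmod (of_uhp z' - of_uhp w'))\<^sup>2 / (2 * Im (of_uhp z') * Im (of_uhp w'))"
    unfolding hdist_def by (rule inj[OF pos pos])
  moreover have half: "p / (2 * x * y) = p / (x * y) / 2" for p x y :: real
    by simp
  ultimately show ?thesis unfolding half divide_cancel_right by simp
qed

text \<open>The derivative at \<open>\<zeta>\<close> of \<open>2 (cosh d - 1)\<close>, where \<open>d\<close> is the hyperbolic distance to \<open>w\<close>.\<close>

definition sep_deriv :: "complex \<Rightarrow> complex \<Rightarrow> complex \<Rightarrow> real" where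
  "sep_deriv w \<zeta> h = 2 * ((\<zeta> - w) \<bullet> h) / (Im \<zeta> * Im w)
     - (cmod (\<zeta> - w))\<^sup>2 / (Im \<zeta> * Im w) * (Im h / Im \<zeta>)"

lemma sep_has_derivative:
  assumes "0 < Im \<zeta>" "0 < Im w"
  shows "((\<lambda>\<zeta>. (cmod (\<zeta> - w))\<^sup>2 / (Im \<zeta> * Im w)) has_derivative sep_deriv w \<zeta>) (at \<zeta>)"
proof -
  have "((\<lambda>\<zeta>. ((\<zeta> - w) \<bullet> (\<zeta> - w)) / (Im \<zeta> * Im w)) has_derivative
      (\<lambda>h. 2 * ((\<zeta> - w) \<bullet> h) / (Im \<zeta> * Im w)
        - ((\<zeta> - w) \<bullet> (\<zeta> - w)) / (Im \<zeta> * Im w) * (Im h / Im \<zeta>))) (at \<zeta>)"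
    using assms
    by (auto intro!: derivative_eq_intros bounded_linear.has_derivative[OF bounded_linear_Im]
        simp: fun_eq_iff inner_commute field_simps)
  then show ?thesis
    by (simp add: sep_deriv_def[abs_def] power2_norm_eq_inner)
qed

lemma linear_sep_deriv: "linear (sep_deriv w \<zeta>)"
  unfolding sep_deriv_def
  by (rule linearI)
     (simp_all add: inner_add_right add_divide_distrib right_diff_distrib distrib_left mult.left_commute)

text \<open>Distance and direction from \<open>\<zeta>\<close> determine a point. With the values equal, the terms of the
  derivative that contain them cancel; the direction \<open>\<i>\<close> then gives equal imaginary parts, and the
  direction \<open>1\<close> equal real parts.\<close>

lemma sep_gradient_determines_point:
  assumes "0 < Im \<zeta>" "0 < Im w" "0 < Im w'"
    and val: "(cmod (\<zeta> - w))\<^sup>2 / (Im \<zeta> * Im w) = (cmod (\<zeta> - w'))\<^sup>2 / (Im \<zeta> * Im w')"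
    and der: "sep_deriv w \<zeta> = sep_deriv w' \<zeta>"
  shows "w = w'"
proof -
  have gradient: "(\<zeta> - w) \<bullet> h / Im w = (\<zeta> - w') \<bullet> h / Im w'" for h
  proof -
    have "2 * ((\<zeta> - w) \<bullet> h) / (Im \<zeta> * Im w) = 2 * ((\<zeta> - w') \<bullet> h) / (Im \<zeta> * Im w')"
      using fun_cong[OF der, of h] unfolding sep_deriv_def val by simp
    then have "(2 / Im \<zeta>) * ((\<zeta> - w) \<bullet> h / Im w) = (2 / Im \<zeta>) * ((\<zeta> - w') \<bullet> h / Im w')"
      by simp
    then show ?thesis using assms(1) by (simp only: mult_cancel_left) simp
  qed
  have "(Im \<zeta> - Im w) / Im w = (Im \<zeta> - Im w') / Im w'"
    using gradient[of \<i>] by (simp add: inner_complex_def)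
  then have "Im w = Im w'" using assms by (simp add: field_simps)
  moreover have "(Re \<zeta> - Re w) / Im w = (Re \<zeta> - Re w') / Im w'"
    using gradient[of 1] by (simp add: inner_complex_def)
  ultimately show ?thesis using assms by (simp add: complex_eq_iff)
qed

text \<open>For a point \<open>p\<close>, an isometry \<open>C\<close> satisfies \<open>d (C p) (C \<zeta>) = d p \<zeta>\<close>. Differentiating at the base point of \<open>F\<close>
  shows that the derivative of the distance to \<open>C p\<close>, evaluated on the frame \<open>G\<close>, depends only
  on \<open>p\<close> and \<open>F\<close>. As \<open>G\<close> spans the tangent plane, this fixes the gradient of that distance at the base
  point of \<open>G\<close>, and with it \<open>C p\<close>.\<close>

lemma isometry_determined_by_frame:
  assumes A: "A \<in> uhp_isometries" "maps_frame A F G"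
    and B: "B \<in> uhp_isometries" "maps_frame B F G"
    and G: "is_frame G"
  shows "A = B"
proof
  fix p
  obtain z v w where F: "F = (z, v, w)" by (metis prod_cases3)
  obtain z' v' w' where G': "G = (z', v', w')" by (metis prod_cases3)
  let ?sep = "\<lambda>q \<zeta>. (cmod (\<zeta> - of_uhp q))\<^sup>2 / (Im \<zeta> * Im (of_uhp q))"
  let ?L = "\<lambda>q. sep_deriv (of_uhp q) (of_uhp z')"
  have chain: "\<exists>E. (?sep p has_derivative E) (at (of_uhp z)) \<and> E v = ?L (C p) v' \<and> E w = ?L (C p) w'
      \<and> ?sep p (of_uhp z) = ?sep (C p) (of_uhp z')"
    if C: "C \<in> uhp_isometries" "maps_frame C F G" for C
  proof -
    from C(2) obtain D where D: "C z = z'" "D v = v'" "D w = w'"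
        "((\<lambda>\<zeta>. of_uhp (C (Uhp \<zeta>))) has_derivative D) (at (of_uhp z))"
      by (auto simp: maps_frame_def F G')
    have iso: "?sep (C p) (of_uhp (C q)) = ?sep p (of_uhp q)" for q
      using C(1) by (simp add: uhp_isometries_def flip: hdist_eq_iff)
    have "of_uhp z' = of_uhp (C (Uhp (of_uhp z)))" using D(1) by (simp add: of_uhp_inverse)
    then have "(?sep (C p) \<circ> (\<lambda>\<zeta>. of_uhp (C (Uhp \<zeta>))) has_derivative ?L (C p) \<circ> D) (at (of_uhp z))"
      using sep_has_derivative[OF Im_of_uhp Im_of_uhp] by (intro diff_chain_at[OF D(4)]) simp
    then have "(?sep p has_derivative ?L (C p) \<circ> D) (at (of_uhp z))"
    proof (rule has_derivative_transform_within_open[OF _ open_upper_half_plane])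
      fix \<zeta> assume "\<zeta> \<in> {\<zeta>. 0 < Im \<zeta>}"
      then show "(?sep (C p) \<circ> (\<lambda>\<zeta>. of_uhp (C (Uhp \<zeta>)))) \<zeta> = ?sep p \<zeta>"
        using iso[of "Uhp \<zeta>"] by (simp add: Uhp_inverse)
    qed (simp add: Im_of_uhp)
    then show ?thesis using D iso[of z] by (intro exI[of _ "?L (C p) \<circ> D"]) simp
  qed
  obtain E where E: "(?sep p has_derivative E) (at (of_uhp z))" "E v = ?L (A p) v'" "E w = ?L (A p) w'"
      "?sep p (of_uhp z) = ?sep (A p) (of_uhp z')"
    using chain[OF A] by auto
  obtain E' where E': "(?sep p has_derivative E') (at (of_uhp z))" "E' v = ?L (B p) v'" "E' w = ?L (B p) w'"
      "?sep p (of_uhp z) = ?sep (B p) (of_uhp z')"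
    using chain[OF B] by auto
  have "E = E'" using E(1) E'(1) by (rule has_derivative_unique)
  then have "?L (A p) h = ?L (B p) h" for h
    using E E' frame_span[OF G[unfolded G']]
    by (intro linear_eq_on[OF linear_sep_deriv linear_sep_deriv, of h "{v', w'}"]) auto
  then have "of_uhp (A p) = of_uhp (B p)"
    using E(4) E'(4) by (intro sep_gradient_determines_point[of "of_uhp z'"]) (auto simp: Im_of_uhp)
  then show "A p = B p" by (simp add: of_uhp_inject)
qed


lemma moebius_maps_frame_inverse:
  assumes "M \<in> SL2Z" "is_frame F" "maps_frame (moebius_uhp M) F G"
  shows "maps_frame (moebius_uhp (mat_adj M)) G F"
proof -
  obtain G' where "is_frame G'" "maps_frame (moebius_uhp M) F G'"
    using moebius_maps_frame[OF assms(1,2)] .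
  then have "is_frame G" using maps_frame_unique[OF assms(3)] by simp
  then obtain F' where F': "maps_frame (moebius_uhp (mat_adj M)) G F'"
    using moebius_maps_frame[OF mat_adj_in_SL2Z[OF assms(1)]] by blast
  have "moebius_uhp (mat_adj M) \<circ> moebius_uhp M = id"
    using assms(1) by (auto simp: moebius_uhp_adj_left)
  then have "maps_frame id F F'" using maps_frame_compose[OF assms(3) F'] by simp
  then have "F' = F" using maps_frame_unique maps_frame_id by blast
  then show ?thesis using F' by simp
qed

section \<open>Lifting the frame field to the leaf\<close>

lemma mem_leaf_frame_self: "(F, t) \<in> leaf_frame (F, t)"
proof -
  have "moebius_uhp (1, 0, 0, 1) = id" by (rule ext) (simp only: moebius_uhp_one id_apply)
  then have "maps_frame (moebius_uhp (1, 0, 0, 1)) F F" by (simp only: maps_frame_id)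
  then show ?thesis
    unfolding leaf_frame_def prod.case mem_Collect_eq
    using one_in_SL2Z moebius_bdry_one by blast
qed

text \<open>Half of the fact that a leafwise frame depends only on the orbit of its representative; applied
  to the inverse element it yields the other half.\<close>

lemma leaf_frame_moebius_subset:
  assumes "M \<in> SL2Z" "maps_frame (moebius_uhp M) F G"
  shows "leaf_frame (G, moebius_bdry M t) \<subseteq> leaf_frame (F, t)"
proof
  fix p assume p: "p \<in> leaf_frame (G, moebius_bdry M t)"
  obtain H s where Hs: "p = (H, s)" by (cases p)
  obtain N where N: "N \<in> SL2Z" "maps_frame (moebius_uhp N) G H" "moebius_bdry N (moebius_bdry M t) = s"
    using p by (auto simp: Hs leaf_frame_def)
  have "maps_frame (moebius_uhp N \<circ> moebius_uhp M) F H"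
    using assms(2) N(2) by (rule maps_frame_compose)
  moreover have "moebius_uhp N \<circ> moebius_uhp M = moebius_uhp (mat_mult N M)"
    using N(1) assms(1) by (simp add: fun_eq_iff moebius_uhp_mult)
  ultimately have "maps_frame (moebius_uhp (mat_mult N M)) F H" by simp
  then show "p \<in> leaf_frame (F, t)"
    using N assms(1) mat_mult_in_SL2Z[OF N(1) assms(1)]
    by (auto simp: Hs leaf_frame_def moebius_bdry_mult intro!: bexI[of _ "mat_mult N M"])
qed

lemma leaf_frame_moebius:
  assumes "M \<in> SL2Z" "is_frame F" "maps_frame (moebius_uhp M) F G"
  shows "leaf_frame (G, moebius_bdry M t) = leaf_frame (F, t)"
proof
  show "leaf_frame (G, moebius_bdry M t) \<subseteq> leaf_frame (F, t)"
    using assms(1,3) by (rule leaf_frame_moebius_subset)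
  have "moebius_bdry (mat_adj M) (moebius_bdry M t) = t"
    using assms(1)
    by (simp add: mat_adj_in_SL2Z mat_adj_left_inverse moebius_bdry_one flip: moebius_bdry_mult)
  then show "leaf_frame (F, t) \<subseteq> leaf_frame (G, moebius_bdry M t)"
    using leaf_frame_moebius_subset[OF mat_adj_in_SL2Z[OF assms(1)] moebius_maps_frame_inverse[OF assms],
        of "moebius_bdry M t"] by simp
qed

lemma fst_leaf_frame: "fst ` leaf_frame (F, t) = surface_frame F"
proof (intro equalityI subsetI)
  fix G assume "G \<in> surface_frame F"
  then obtain M where "M \<in> SL2Z" "maps_frame (moebius_uhp M) F G"
    by (auto simp: surface_frame_def)
  then have "(G, moebius_bdry M t) \<in> leaf_frame (F, t)" by (auto simp: leaf_frame_def)
  then show "G \<in> fst ` leaf_frame (F, t)" by (rule rev_image_eqI) simp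
qed (auto simp: leaf_frame_def surface_frame_def)

lemma non_elliptic_stabilizer:
  assumes "\<not> elliptic z" "M \<in> SL2Z" "moebius_uhp M z = z"
  shows "moebius_uhp M = id"
  using assms by (auto simp: elliptic_def PSL2Z_def)

lemma non_elliptic_same_image:
  assumes "\<not> elliptic z" "M \<in> SL2Z" "N \<in> SL2Z" "moebius_uhp M z = moebius_uhp N z"
  shows "moebius_uhp M = moebius_uhp N"
proof -
  have "moebius_uhp (mat_mult (mat_adj N) M) z = z"
    using assms by (simp add: moebius_uhp_mult mat_adj_in_SL2Z moebius_uhp_adj_left)
  then have "moebius_uhp (mat_mult (mat_adj N) M) = id"
    using assms by (intro non_elliptic_stabilizer) (auto intro: mat_mult_in_SL2Z mat_adj_in_SL2Z)
  then have "moebius_uhp (mat_adj N) (moebius_uhp M w) = w" for w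
    using assms(2,3) by (metis id_apply mat_adj_in_SL2Z moebius_uhp_mult)
  then show ?thesis
    using moebius_uhp_adj_right[OF assms(3)] by (metis ext)
qed

lemma non_elliptic_moebius:
  assumes "\<not> elliptic z" "M \<in> SL2Z"
  shows "\<not> elliptic (moebius_uhp M z)"
proof -
  have "moebius_uhp N = id" if N: "N \<in> SL2Z" "moebius_uhp N (moebius_uhp M z) = moebius_uhp M z" for N
  proof -
    have "moebius_uhp (mat_mult N M) = moebius_uhp M"
      using N assms by (intro non_elliptic_same_image) (auto simp: moebius_uhp_mult mat_mult_in_SL2Z)
    then have "moebius_uhp N (moebius_uhp M w) = moebius_uhp M w" for w
      using N(1) assms(2) by (metis moebius_uhp_mult)
    then have "moebius_uhp N w = w" for w
      using moebius_uhp_adj_right[OF assms(2)] by metis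
    then show ?thesis by auto
  qed
  then show ?thesis by (auto simp: elliptic_def PSL2Z_def)
qed

text \<open>The definite description in the lift of the frame field denotes: some element of the group
  moves the frame of the field to the point \<open>(z, r)\<close>, and two candidates over \<open>z\<close> differ by an element fixing
  \<open>z\<close>, which is trivial as \<open>z\<close> is not elliptic.\<close>

lemma frame_lift_props:
  assumes "\<not> elliptic z" "f (leaf_cover r z) \<in> leaf_frames_at (leaf_cover r z)"
  shows "is_frame (frame_lift r f z) \<and> fst (frame_lift r f z) = z
     \<and> leaf_frame (frame_lift r f z, r) = f (leaf_cover r z)"
  unfolding frame_lift_def
proof (rule theI')
  obtain F t where F: "is_frame F" "spt (fst F, t) = spt (z, r)"
      "f (leaf_cover r z) = leaf_frame (F, t)"
    using assms(2) by (auto simp: leaf_frames_at_def leaf_cover_def)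
  have "(z, r) \<in> spt (fst F, t)" using mem_spt_self F(2) by metis
  then obtain M where M: "M \<in> SL2Z" "moebius_uhp M (fst F) = z" "moebius_bdry M t = r"
    by (auto simp: spt_def act_def)
  obtain G where G: "is_frame G" "maps_frame (moebius_uhp M) F G"
    using moebius_maps_frame[OF M(1) F(1)] .
  show "\<exists>!F. is_frame F \<and> fst F = z \<and> leaf_frame (F, r) = f (leaf_cover r z)"
  proof (rule ex1I[of _ G])
    show "is_frame G \<and> fst G = z \<and> leaf_frame (G, r) = f (leaf_cover r z)"
      using G M F(3) leaf_frame_moebius[OF M(1) F(1) G(2), of t] maps_frame_fst[OF G(2)] by simp
  next
    fix H assume H: "is_frame H \<and> fst H = z \<and> leaf_frame (H, r) = f (leaf_cover r z)"
    have "leaf_frame (H, r) = leaf_frame (G, r)"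
      using H M F(3) leaf_frame_moebius[OF M(1) F(1) G(2), of t] by simp
    then have "(G, r) \<in> leaf_frame (H, r)" using mem_leaf_frame_self by simp
    then obtain N where N: "N \<in> SL2Z" "maps_frame (moebius_uhp N) H G"
      by (auto simp: leaf_frame_def)
    have "moebius_uhp N z = z"
      using maps_frame_fst[OF N(2)] maps_frame_fst[OF G(2)] H M(2) by simp
    then have "moebius_uhp N = id" using N(1) assms(1) non_elliptic_stabilizer by blast
    then show "H = G" using N(2) maps_frame_unique maps_frame_id by metis
  qed
qed

text \<open>The lifted frames at \<open>xt\<close> and at \<open>M xt\<close> project to the same frame of the modular surface, so some \<open>N\<close> in
  the group takes one to the other. It agrees with \<open>M\<close> at \<open>xt\<close>, hence everywhere.\<close>

lemma frame_lift_equivariant: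
  assumes "\<not> elliptic xt" "lifted_frame_field (fiber_transversal (leaf_cover r xt)) \<phi> f" "M \<in> SL2Z"
  shows "maps_frame (moebius_uhp M) (frame_lift r f xt) (frame_lift r f (moebius_uhp M xt))"
    and "is_frame (frame_lift r f (moebius_uhp M xt))"
proof -
  let ?F = "\<lambda>N. frame_lift r f (moebius_uhp N xt)"
  have lift: "is_frame (?F N) \<and> fst (?F N) = moebius_uhp N xt \<and> surface_frame (?F N) = \<phi>"
    if N: "N \<in> SL2Z" for N
  proof -
    have "leaf_cover r (moebius_uhp N xt) \<in> fiber_transversal (leaf_cover r xt)"
      by (simp add: fiber_transversal_def leaf_cover_def suspension_def proj_spt
          surface_pt_moebius[OF N])
    then have f: "f (leaf_cover r (moebius_uhp N xt)) \<in> leaf_frames_at (leaf_cover r (moebius_uhp N xt))"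
        "fst ` f (leaf_cover r (moebius_uhp N xt)) = \<phi>"
      using assms(2) by (auto simp: lifted_frame_field_def)
    have F: "is_frame (?F N)" "fst (?F N) = moebius_uhp N xt"
        "leaf_frame (?F N, r) = f (leaf_cover r (moebius_uhp N xt))"
      using frame_lift_props[where f = f, OF non_elliptic_moebius[OF assms(1) N] f(1)] by blast+
    have "surface_frame (?F N) = \<phi>"
      using f(2) by (simp only: fst_leaf_frame flip: F(3))
    then show ?thesis using F by simp
  qed
  have xt: "?F (1, 0, 0, 1) = frame_lift r f xt" by (simp add: moebius_uhp_one)
  show "is_frame (?F M)" using lift[OF assms(3)] by simp
  have "?F M \<in> surface_frame (?F M)"
    using imageI[OF mem_leaf_frame_self[of "?F M" r], of fst] by (simp only: fst_leaf_frame fst_conv)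
  then have "?F M \<in> surface_frame (frame_lift r f xt)"
    using lift[OF assms(3)] lift[OF one_in_SL2Z] by (simp add: xt)
  then obtain N where N: "N \<in> SL2Z" "maps_frame (moebius_uhp N) (frame_lift r f xt) (?F M)"
    by (auto simp: surface_frame_def)
  have "moebius_uhp N xt = moebius_uhp M xt"
    using maps_frame_fst[OF N(2)] lift[OF assms(3)] lift[OF one_in_SL2Z]
    by (simp add: xt moebius_uhp_one)
  then have "moebius_uhp N = moebius_uhp M"
    using non_elliptic_same_image assms(1,3) N(1) by blast
  then show "maps_frame (moebius_uhp M) (frame_lift r f xt) (?F M)" using N(2) by simp
qed

section \<open>Diophantine approximations\<close>

lemma diophantine_approximation_in_PSL2Z:
  assumes "\<not> elliptic xt" "lifted_frame_field (fiber_transversal (leaf_cover r xt)) \<phi> f"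
    and "diophantine_approximation r (fiber_transversal (leaf_cover r xt)) f xt A"
  shows "A n \<in> PSL2Z"
proof -
  obtain yt where yt: "\<And>n. leaf_cover r (yt n) \<in> fiber_transversal (leaf_cover r xt)"
      and A: "\<And>n. A n \<in> uhp_isometries" "\<And>n. maps_frame (A n) (frame_lift r f xt) (frame_lift r f (yt n))"
    using assms(3) unfolding diophantine_approximation_def by (metis IntD1)
  have "surface_pt (yt n) = surface_pt xt"
    using yt[of n] by (simp add: fiber_transversal_def leaf_cover_def proj_spt)
  then have "yt n \<in> surface_pt xt" using mem_surface_pt_self by metis
  then obtain M where M: "M \<in> SL2Z" "yt n = moebius_uhp M xt" by (auto simp: surface_pt_def)
  have "A n = moebius_uhp M"
    using A[of n] frame_lift_equivariant[OF assms(1,2) M(1)] moebius_isometry[OF M(1)] M(2)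
    by (intro isometry_determined_by_frame) auto
  then show ?thesis using M(1) by (simp add: PSL2Z_def)
qed

lemma diophantine_approximationI:
  assumes "\<not> elliptic xt" "lifted_frame_field (fiber_transversal (leaf_cover (Some r) xt)) \<phi> f"
    and M: "\<And>n. M n \<in> SL2Z"
    and s: "\<And>n. moebius_bdry (mat_adj (M n)) (Some r) = Some (s n)" "s \<longlonglongrightarrow> r"
  shows "diophantine_approximation (Some r) (fiber_transversal (leaf_cover (Some r) xt)) f xt
     (\<lambda>n. moebius_uhp (M n))"
proof -
  let ?T = "fiber_transversal (leaf_cover (Some r) xt)"
  let ?y = "\<lambda>n. leaf_cover (Some r) (moebius_uhp (M n) xt)"
  have mem: "leaf_cover (Some r) xt \<in> ?T" "?y n \<in> ?T" for n
    by (simp_all add: fiber_transversal_def leaf_cover_def suspension_def proj_spt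
        surface_pt_moebius[OF M])
  have "?y n = spt (xt, Some (s n))" for n
    by (simp add: leaf_cover_def spt_moebius_uhp[OF M] s(1))
  then have "limitin suspension_topology ?y (leaf_cover (Some r) xt) sequentially"
    using limitin_spt_bdry[OF s(2), of xt] by (simp add: leaf_cover_def)
  then have "limitin (subtopology suspension_topology ?T) ?y (leaf_cover (Some r) xt) sequentially"
    using mem by (simp add: limitin_subtopology)
  then show ?thesis
    unfolding diophantine_approximation_def
    using mem(2) moebius_isometry[OF M] frame_lift_equivariant(1)[OF assms(1,2) M]
    by (intro exI[of _ ?y] exI[of _ "\<lambda>n. moebius_uhp (M n) xt"]) (auto simp: leaf_def)
qed

text \<open>The image of \<open>0\<close> under \<open>M n\<close> is \<open>b / d\<close>, possibly infinite, and the shear with parameter \<open>k\<close> takes it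
  to \<open>b / (k b + d)\<close>. The parameter \<open>n + 1 + \<bar>d\<bar>\<close> is large enough to absorb \<open>d\<close> and leave
  a denominator of size at least \<open>(n + 1) \<bar>b\<bar>\<close>; when \<open>b = 0\<close> the image is \<open>0\<close> for every \<open>k\<close>.\<close>

lemma shear_contracts_to_zero:
  assumes "\<And>n. M n \<in> SL2Z"
  obtains k :: "nat \<Rightarrow> int" and s where
    "\<And>n. moebius_bdry (mat_mult (1, 0, k n, 1) (M n)) (Some 0) = Some (s n)" "s \<longlonglongrightarrow> 0"
proof -
  define b d where "b n = fst (snd (M n))" and "d n = snd (snd (snd (M n)))" for n
  define k where "k n = int (Suc n) + \<bar>d n\<bar>" for n
  define q where "q n = k n * b n + d n" for n
  have row: "(b n, d n) \<noteq> (0, 0)" for n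
    using assms[of n] by (auto simp: SL2Z_def b_def d_def split: prod.splits)
  have q: "int (Suc n) * \<bar>b n\<bar> \<le> \<bar>q n\<bar>" for n
  proof (cases "b n = 0")
    case False
    then have "\<bar>d n\<bar> * 1 \<le> \<bar>d n\<bar> * \<bar>b n\<bar>" by (intro mult_left_mono) auto
    moreover have "\<bar>k n * b n\<bar> = int (Suc n) * \<bar>b n\<bar> + \<bar>d n\<bar> * \<bar>b n\<bar>"
    proof -
      have "\<bar>k n\<bar> = int (Suc n) + \<bar>d n\<bar>" by (simp add: k_def)
      then show ?thesis by (simp only: abs_mult distrib_right)
    qed
    ultimately show ?thesis unfolding q_def by linarith
  qed simp
  have q0: "q n \<noteq> 0" for n
  proof
    assume "q n = 0"
    then have "int (Suc n) * \<bar>b n\<bar> \<le> 0" using q[of n] by simp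
    then have "b n = 0" by (simp add: mult_le_0_iff)
    then show False using row[of n] \<open>q n = 0\<close> by (simp add: q_def)
  qed
  define s where "s n = real_of_int (b n) / of_int (q n)" for n
  have image: "moebius_bdry (mat_mult (1, 0, k n, 1) (M n)) (Some 0) = Some (s n)" for n
    using q0[of n] by (cases "M n") (simp add: mat_mult_def moebius_bdry_def s_def b_def d_def q_def
        flip: of_int_mult of_int_add)
  have bound: "u / v \<le> 1 / m" if "m * u \<le> v" "0 < v" "0 < m" for u v m :: real
    using that by (simp add: field_simps)
  have lim: "s \<longlonglongrightarrow> 0"
  proof (rule Lim_null_comparison[OF always_eventually LIMSEQ_inverse_real_of_nat], intro allI)
    fix n
    have "real_of_int (int (Suc n) * \<bar>b n\<bar>) \<le> of_int \<bar>q n\<bar>"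
      using q by (simp only: of_int_le_iff)
    then have "real (Suc n) * \<bar>real_of_int (b n)\<bar> \<le> \<bar>real_of_int (q n)\<bar>"
      by simp
    moreover have "0 < \<bar>real_of_int (q n)\<bar>" using q0 by simp
    ultimately have "\<bar>real_of_int (b n)\<bar> / \<bar>real_of_int (q n)\<bar> \<le> 1 / real (Suc n)"
      by (intro bound) auto
    then show "norm (s n) \<le> inverse (real (Suc n))"
      by (simp add: s_def inverse_eq_divide)
  qed
  from image lim show ?thesis by (rule that)
qed

theorem theorem11:
  fixes U :: "nat filter" and xt :: uhp and x :: spoint and T :: "spoint set"
    and \<phi> :: "frame set" and f :: "spoint \<Rightarrow> (frame \<times> bdry) set"
  assumes "free_ultrafilter U"
    and "x = leaf_cover (Some 0) xt"
    and "\<not> elliptic xt"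
    and "T = fiber_transversal x"
    and "\<phi> \<in> surface_frames_at (proj x)"
    and "lifted_frame_field T \<phi> f"
  shows "fundamental_germ U (Some 0) T f xt = PSL2_starZ U"
proof -
  have T: "T = fiber_transversal (leaf_cover (Some 0) xt)" using assms(2,4) by simp
  note f = assms(6)[unfolded T]
  have "fundamental_germ U (Some 0) T f xt = star U PSL2Z"
  proof (intro equalityI subsetI)
    fix G assume "G \<in> fundamental_germ U (Some 0) T f xt"
    then obtain A B where G: "G = star_class U (\<lambda>n. A n \<circ> inv (B n))"
      and A: "diophantine_approximation (Some 0) T f xt A"
      and B: "diophantine_approximation (Some 0) T f xt B"
      by (auto simp: fundamental_germ_def)
    have "A n \<circ> inv (B n) \<in> PSL2Z" for n
      using diophantine_approximation_in_PSL2Z[OF assms(3) f] A B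
      by (simp add: T PSL2Z_compose_inv)
    then show "G \<in> star U PSL2Z" by (auto simp: G star_def)
  next
    fix G assume "G \<in> star U PSL2Z"
    then obtain g where G: "G = star_class U g" and "\<forall>n. g n \<in> PSL2Z" by (auto simp: star_def)
    then have "\<forall>n. \<exists>M. M \<in> SL2Z \<and> g n = moebius_uhp M" unfolding PSL2Z_def by blast
    then obtain M where M: "\<And>n. M n \<in> SL2Z" "\<And>n. g n = moebius_uhp (M n)" by metis
    obtain k s where s: "\<And>n. moebius_bdry (mat_mult (1, 0, k n, 1) (M n)) (Some 0) = Some (s n)"
        "s \<longlonglongrightarrow> 0"
      using shear_contracts_to_zero[of M] M(1) by blast
    \<comment> \<open>The shears fix \<open>0\<close>, so their inverses are approximations based at the constant sequence \<open>x\<close>.\<close>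
    define P :: "nat \<Rightarrow> imat" where "P n = (1, 0, k n, 1)" for n
    have P: "P n \<in> SL2Z" "mat_mult (P n) (M n) \<in> SL2Z" for n
    proof -
      show "P n \<in> SL2Z" by (simp add: P_def SL2Z_def)
      then show "mat_mult (P n) (M n) \<in> SL2Z" using M(1) by (rule mat_mult_in_SL2Z)
    qed
    have adj_adj: "mat_adj (mat_adj N) = N" for N
      by (cases N) (simp add: mat_adj_def)
    have "diophantine_approximation (Some 0) T f xt (\<lambda>n. moebius_uhp (mat_adj (P n)))"
      unfolding T using assms(3) f
      by (rule diophantine_approximationI[where s = "\<lambda>_. 0"])
         (auto simp: P mat_adj_in_SL2Z adj_adj, simp add: P_def moebius_bdry_def)
    moreover have "diophantine_approximation (Some 0) T f xt
        (\<lambda>n. moebius_uhp (mat_adj (mat_mult (P n) (M n))))"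
      unfolding T using assms(3) f
      by (rule diophantine_approximationI[where s = s])
         (use s in \<open>auto simp: P mat_adj_in_SL2Z adj_adj P_def[symmetric]\<close>)
    moreover have "moebius_uhp (mat_adj (P n)) \<circ> inv (moebius_uhp (mat_adj (mat_mult (P n) (M n)))) = g n" for n
      using M P by (simp add: fun_eq_iff inv_moebius_uhp mat_adj_in_SL2Z adj_adj moebius_uhp_mult
          moebius_uhp_adj_left)
    ultimately show "G \<in> fundamental_germ U (Some 0) T f xt"
      unfolding fundamental_germ_def G mem_Collect_eq
      by (intro exI[of _ "\<lambda>n. moebius_uhp (mat_adj (P n))"]
          exI[of _ "\<lambda>n. moebius_uhp (mat_adj (mat_mult (P n) (M n)))"]) simp
  qed
  then show ?thesis by (simp add: PSL2_starZ_eq_star)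
qed

end
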